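(* Let $T$ be a plane tree of the form $\mathcal{T}(w)$ for a word $w$ of length $n$, and let $1\le k\le n-1$. If the $k$-th and $(k+1)$-th sectors of $T$ are not attached to the same vertex, then $d_k(\mathcal{M}_T)=0$. If they are attached to the same vertex, then $d_k(\mathcal{M}_T)=\mathcal{M}_{T'}$, where $T'$ is obtained from $T$ by gluing the $k$-th and $(k+1)$-th sectors (i.e. deleting the leaf lying between these two consecutive sectors at that vertex).
   Context: Let $A=\{a_1<a_2<\cdots\}$ be an infinite totally ordered alphabet (identified with $\{1<2<\cdots\}$) and $\mathbb{K}$ a field; work with formal $\mathbb{K}$-linear combinations of words over $A$. For a word $w$ with distinct letters $b_1<\dots<b_r$, $\mathrm{pack}(w)$ is the image of $w$ under $b_i\mapsto i$; $w$ is packed if $\mathrm{pack}(w)=w$; $\mathbf{M}_u=\sum_{\mathrm{pack}(w)=u}w$. The linear operator $d_k$ is defined on words by $d_k(w)=uav$ if $w=uaav$ with $a$ a letter and $|u|=k-1$, and $d_k(w)=0$ otherwise. With every word $w$ associate a plane tree $\mathcal{T}(w)$: $\mathcal{T}(\varepsilon)$ is a single leaf; otherwise, if $m=\max(w)$ occurs exactly $j-1$ times, write $w=v_1mv_2\cdots v_{j-1}mv_j$ and let $\mathcal{T}(w)$ be the tree whose root has the $j$ subtrees $\mathcal{T}(v_1),\dots,\mathcal{T}(v_j)$ in this order (so $\mathcal{T}(w)$ has $|w|+1$ leaves). The gaps between two consecutive children of an internal vertex are called sectors; the sectors of $\mathcal{T}(w)$ are ordered from left to right recursively (the sectors of $\mathcal{T}(v_1)$,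 then the first root sector, then the sectors of $\mathcal{T}(v_2)$, etc.), so that the $i$-th sector corresponds to the letter $w_i$. For a plane tree $T$, $\mathcal{M}_T=\sum_{u\text{ packed},\ \mathcal{T}(u)=T}\mathbf{M}_u$. *)

theory Defs
  imports Main
begin

text \<open>The alphabet is \<open>{1 < 2 < \<dots>}\<close>, realised as the positive natural numbers.\<close>

definition words :: "nat list set" where
  "words = lists {a. 1 \<le> a}"

text \<open>
  The letter \<open>b\<^sub>i\<close> is sent to its rank \<open>i\<close> among the distinct letters
  \<open>b\<^sub>1 < \<dots> < b\<^sub>r\<close> of the word.
\<close>

definition pack :: "nat list \<Rightarrow> nat list" where
  "pack w = map (\<lambda>a. card {b \<in> set w. b \<le> a}) w"

definition packed :: "nat list \<Rightarrow> bool" where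
  "packed w \<longleftrightarrow> w \<in> words \<and> pack w = w"

text \<open>
  A formal, possibly infinite, linear combination of words is given by its coefficient
  function; the function is zero outside \<^const>\<open>words\<close>.
\<close>

type_synonym 'k series = "nat list \<Rightarrow> 'k"

definition M_word :: "nat list \<Rightarrow> 'k::field series" where
  "M_word u = (\<lambda>w. if w \<in> words \<and> pack w = u then 1 else 0)"

text \<open>
  The action of \<open>d\<^sub>k\<close> on a single word, for \<open>k \<ge> 1\<close>; \<^const>\<open>None\<close> stands for the value 0.
\<close>

definition d_word :: "nat \<Rightarrow> nat list \<Rightarrow> nat list option" where
  "d_word k w = (case drop (k - 1) w of
      a # b # v \<Rightarrow> if a = b then Some (take (k - 1) w @ a # v) else None
    | _ \<Rightarrow> None)"

text \<open>
  Linear extension of \<^const>\<open>d_word\<close> to formal combinations: the coefficient of \<open>v\<close> collects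
  the coefficients of all words sent to \<open>v\<close>. There is at most one such word, so the sum is finite
  even if the combination is infinite.
\<close>

definition d_op :: "nat \<Rightarrow> 'k::field series \<Rightarrow> 'k series" where
  "d_op k f = (\<lambda>v. \<Sum>w \<in> {w \<in> words. d_word k w = Some v}. f w)"

lemma d_word_eq_Some_iff:
  assumes "1 \<le> k"
  shows "d_word k w = Some x \<longleftrightarrow>
    (\<exists>u a v. w = u @ a # a # v \<and> length u = k - 1 \<and> x = u @ a # v)"
proof
  assume "d_word k w = Some x"
  then obtain a v where "drop (k - 1) w = a # a # v" "x = take (k - 1) w @ a # v"
    by (auto simp: d_word_def split: list.splits if_splits)
  moreover from this have "length (take (k - 1) w) = k - 1"
    by (metis drop_eq_Nil2 length_take linorder_le_cases list.distinct(1) min.absorb2)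
  ultimately show "\<exists>u a v. w = u @ a # a # v \<and> length u = k - 1 \<and> x = u @ a # v"
    by (metis append_take_drop_id)
qed (auto simp: d_word_def)

datatype ptree = Node "ptree list"

abbreviation Leaf :: ptree where
  "Leaf \<equiv> Node []"

text \<open>
  \<open>split_at m w\<close> is the list \<open>[v\<^sub>1, \<dots>, v\<^sub>j]\<close> with \<open>w = v\<^sub>1 m v\<^sub>2 \<dots> m v\<^sub>j\<close> and \<open>m\<close> in no \<open>v\<^sub>i\<close>.
\<close>

fun split_at :: "'a \<Rightarrow> 'a list \<Rightarrow> 'a list list" where
  "split_at m [] = [[]]"
| "split_at m (x # xs) =
     (if x = m then [] # split_at m xs
      else (x # hd (split_at m xs)) # tl (split_at m xs))"

lemma split_at_nonempty [simp]: "split_at m w \<noteq> []"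
  by (cases w) auto

lemma split_at_length_le: "v \<in> set (split_at m w) \<Longrightarrow> length v \<le> length w"
proof (induction w arbitrary: v)
  case (Cons x xs)
  have "hd (split_at m xs) \<in> set (split_at m xs)" by simp
  with Cons show ?case
    by (auto split: if_splits intro: le_SucI dest: list.set_sel(2)[OF split_at_nonempty])
qed simp

lemma split_at_length_less:
  "m \<in> set w \<Longrightarrow> v \<in> set (split_at m w) \<Longrightarrow> length v < length w"
proof (induction w arbitrary: v)
  case (Cons x xs)
  have "hd (split_at m xs) \<in> set (split_at m xs)" by simp
  with Cons show ?case
    by (auto split: if_splits simp: less_Suc_eq_le Suc_le_eq intro: split_at_length_le less_imp_le
        dest: list.set_sel(2)[OF split_at_nonempty])
qed simp

lemma sum_length_split_at:
  "(\<Sum>v\<leftarrow>split_at m w. length v) + length (split_at m w) = Suc (length w)"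
proof (induction w)
  case (Cons x xs)
  then show ?case by (cases "split_at m xs") auto
qed simp

function tree :: "nat list \<Rightarrow> ptree" where
  "tree w = (if w = [] then Leaf else Node (map tree (split_at (Max (set w)) w)))"
  by auto
termination
  by (relation "measure length") (auto intro!: split_at_length_less)

declare tree.simps [simp del]

text \<open>The sum is finite; see the lemma \<open>finite_packed_tree\<close> below.\<close>

definition M_tree :: "ptree \<Rightarrow> 'k::field series" where
  "M_tree T = (\<lambda>w. \<Sum>u \<in> {u. packed u \<and> tree u = T}. M_word u w)"

text \<open>
  A sector is a pair \<open>(p, i)\<close>: the vertex it is attached to, given by the path \<open>p\<close> of child indices
  leading to it from the root, and the index \<open>i\<close> of the child on its left. All indices are 0-based,
  so the sector lies between the children \<open>i\<close> and \<open>i + 1\<close> of \<open>p\<close>. The list is in left-to-right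
  order, so the \<open>k\<close>-th sector is \<open>sectors T ! (k - 1)\<close>.
\<close>

type_synonym sector = "nat list \<times> nat"

function sectors :: "ptree \<Rightarrow> sector list" where
  "sectors (Node ts) =
     concat (map (\<lambda>(i, t). map (\<lambda>(p, s). (i # p, s)) (sectors t) @
                           (if Suc i < length ts then [([], i)] else []))
                 (enumerate 0 ts))"
  by pat_completeness auto
termination
  by (relation "measure size")
     (auto simp: in_set_enumerate_eq less_Suc_eq_le size_list_estimation'[OF nth_mem])

lemma length_sectors_Node:
  "length (sectors (Node ts)) = (\<Sum>t\<leftarrow>ts. length (sectors t)) + (length ts - 1)"
proof -
  have "(\<Sum>(i, t)\<leftarrow>enumerate n ts. length (sectors t) + (if Suc i < n + length ts then 1 else 0))
      = (\<Sum>t\<leftarrow>ts. length (sectors t)) + (length ts - 1)" for n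
  proof (induction ts arbitrary: n)
    case (Cons t ts)
    from Cons[of "Suc n"] show ?case by (cases ts) (simp_all del: sectors.simps)
  qed simp
  from this[of 0] show ?thesis
    by (auto simp: length_concat comp_def case_prod_unfold if_distrib cong: if_cong)
qed

lemma length_sectors_tree: "length (sectors (tree w)) = length w"
proof (induction w rule: length_induct)
  case (1 w)
  show ?case
  proof (cases "w = []")
    case True
    then show ?thesis by (simp add: tree.simps[of "[]"])
  next
    case False
    let ?vs = "split_at (Max (set w)) w"
    have "map (\<lambda>v. length (sectors (tree v))) ?vs = map length ?vs"
      using False 1 split_at_length_less[of "Max (set w)" w] by simp
    moreover have "length ?vs \<ge> 1"
      by (simp add: Suc_le_eq)
    ultimately show ?thesis
      using False sum_length_split_at[of "Max (set w)" w]
      by (simp add: tree.simps[of w] length_sectors_Node comp_def del: sectors.simps map_eq_conv)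
  qed
qed

lemma finite_packed_tree: "finite {u. packed u \<and> tree u = T}"
proof (rule finite_subset)
  let ?n = "length (sectors T)"
  have "a \<le> length u" if "packed u" "a \<in> set u" for u a
  proof -
    from that obtain b where "a = card {c \<in> set u. c \<le> b}"
      unfolding packed_def pack_def by (metis (no_types, lifting) imageE set_map)
    also have "\<dots> \<le> card (set u)" by (intro card_mono) auto
    also have "\<dots> \<le> length u" by (rule card_length)
    finally show ?thesis .
  qed
  then show "{u. packed u \<and> tree u = T} \<subseteq> {u. set u \<subseteq> {..?n} \<and> length u = ?n}"
    using length_sectors_tree by fastforce
qed (rule finite_lists_length_eq, simp)

definition same_vertex :: "ptree \<Rightarrow> nat \<Rightarrow> bool" where
  "same_vertex T k \<longleftrightarrow> fst (sectors T ! (k - 1)) = fst (sectors T ! k)"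

fun delete_child :: "nat list \<Rightarrow> nat \<Rightarrow> ptree \<Rightarrow> ptree" where
  "delete_child [] c (Node ts) = Node (take c ts @ drop (Suc c) ts)"
| "delete_child (q # p) c (Node ts) = Node (ts[q := delete_child p c (ts ! q)])"

text \<open>
  If the \<open>k\<close>-th sector is \<open>(p, i)\<close> and the next one is attached to the same vertex, then the latter
  is \<open>(p, i + 1)\<close>, and the child \<open>i + 1\<close> of \<open>p\<close> between the two has no sectors; in a tree
  \<open>tree w\<close>, where every internal vertex has at least two children, it is therefore a leaf.
\<close>

definition glue :: "ptree \<Rightarrow> nat \<Rightarrow> ptree" where
  "glue T k = (case sectors T ! (k - 1) of (p, i) \<Rightarrow> delete_child p (Suc i) T)"

end

theory Submission
  imports Defs
begin

text \<open>
  Packing does not change \<^const>\<open>tree\<close>, so \<^term>\<open>M_tree T\<close> is the indicator function of the words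
  with tree \<open>T\<close>. A word \<open>x a y\<close> has a single preimage \<open>x a a y\<close> under \<open>d\<^sub>k\<close> if \<open>|x| = k - 1\<close>, so it
  remains to compare the trees of \<open>x a y\<close> and \<open>x a a y\<close>. Descending from the root, either \<open>a\<close> is the
  maximal letter, and then doubling it inserts a leaf below the root at this sector, or the sector
  lies in one subtree and the comparison continues there.
\<close>

subsection \<open>Packing and trees\<close>

lemma split_at_map:
  assumes "inj_on f (insert m (set w))"
  shows "split_at (f m) (map f w) = map (map f) (split_at m w)"
  using assms
proof (induction w)
  case (Cons x w)
  have "split_at (f m) (map f w) = map (map f) (split_at m w)"
    using Cons.prems by (intro Cons.IH) (auto intro: inj_on_subset)
  moreover have "f x = f m \<longleftrightarrow> x = m"
    using Cons.prems by (auto simp: inj_on_def)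
  ultimately show ?case
    by (simp add: list.map_sel)
qed simp

lemma set_split_at_subset: "v \<in> set (split_at m w) \<Longrightarrow> set v \<subseteq> set w"
proof (induction w arbitrary: v)
  case (Cons x w)
  then show ?case
    by (cases "split_at m w") (fastforce split: if_splits)+
qed simp

lemma obtain_max_letter:
  fixes w :: "'a::linorder list"
  assumes "w \<noteq> []"
  obtains m where "m \<in> set w" and "\<And>c. c \<in> set w \<Longrightarrow> c \<le> m"
  using assms that[of "Max (set w)"] by simp

lemma tree_eq_Node:
  assumes "m \<in> set w" and "\<And>c. c \<in> set w \<Longrightarrow> c \<le> m"
  shows "tree w = Node (map tree (split_at m w))"
proof -
  have "Max (set w) = m" using assms by (intro Max_eqI) auto
  then show ?thesis using assms(1) by (subst tree.simps) auto
qed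

text \<open>A strictly increasing relabelling sends the maximal letter to the maximal letter and,
  being injective, keeps the positions where it occurs; the same then holds in every block.\<close>

lemma tree_map:
  assumes "strict_mono_on (set w) f"
  shows "tree (map f w) = tree w"
  using assms
proof (induction w rule: length_induct)
  case (1 w)
  show ?case
  proof (cases "w = []")
    case False
    then obtain m where m: "m \<in> set w" "\<And>c. c \<in> set w \<Longrightarrow> c \<le> m"
      using obtain_max_letter by blast
    have le: "f c \<le> f m" if "c \<in> set w" for c
      using strict_mono_on_leD[OF 1(2) that m(1) m(2)[OF that]] .
    have inj: "inj_on f (insert m (set w))"
      using strict_mono_on_imp_inj_on[OF 1(2)] m(1) by (simp add: insert_absorb)
    have "tree (map f w) = Node (map tree (split_at (f m) (map f w)))"
      using m(1) le by (intro tree_eq_Node) auto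
    also have "\<dots> = Node (map (\<lambda>v. tree (map f v)) (split_at m w))"
      by (simp add: split_at_map[OF inj])
    also have "\<dots> = Node (map tree (split_at m w))"
    proof -
      have "tree (map f v) = tree v" if "v \<in> set (split_at m w)" for v
        using 1 split_at_length_less[OF m(1) that]
          monotone_on_subset[OF 1(2) set_split_at_subset[OF that]] by blast
      then show ?thesis by simp
    qed
    also have "\<dots> = tree w"
      using m by (intro tree_eq_Node[symmetric]) auto
    finally show ?thesis .
  qed simp
qed

text \<open>Strictly increasing maps preserve ranks. Since \<open>pack\<close> itself relabels by
  ranks, packing is idempotent.\<close>

lemma pack_map:
  assumes "strict_mono_on (set w) f"
  shows "pack (map f w) = pack w"
proof -
  have "card {b \<in> f ` set w. b \<le> f a} = card {b \<in> set w. b \<le> a}" if "a \<in> set w" for a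
  proof -
    have "{b \<in> f ` set w. b \<le> f a} = f ` {b \<in> set w. b \<le> a}"
      using that strict_mono_on_less_eq[OF assms] by auto
    then show ?thesis
      using strict_mono_on_imp_inj_on[OF assms] by (simp add: card_image inj_on_subset)
  qed
  then show ?thesis by (simp add: pack_def)
qed

lemma strict_mono_on_rank:
  fixes A :: "'a::order set"
  assumes "finite A"
  shows "strict_mono_on A (\<lambda>a. card {b \<in> A. b \<le> a})"
proof (rule strict_mono_onI)
  fix r s assume "r \<in> A" "s \<in> A" "r < s"
  then have "{b \<in> A. b \<le> r} \<subseteq> {b \<in> A. b \<le> s}" "s \<in> {b \<in> A. b \<le> s}" "s \<notin> {b \<in> A. b \<le> r}"
    by auto
  then show "card {b \<in> A. b \<le> r} < card {b \<in> A. b \<le> s}"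
    using assms by (intro psubset_card_mono) auto
qed

lemma tree_pack: "tree (pack w) = tree w"
  unfolding pack_def by (intro tree_map strict_mono_on_rank) simp

lemma packed_pack: "packed (pack w)"
proof -
  have "pack (pack w) = pack w"
    by (subst (2) pack_def) (intro pack_map strict_mono_on_rank, simp)
  moreover have "1 \<le> card {b \<in> set w. b \<le> a}" if "a \<in> set w" for a
    using that by (auto simp: Suc_le_eq card_gt_0_iff)
  then have "pack w \<in> words"
    by (auto simp: words_def pack_def)
  ultimately show ?thesis by (simp add: packed_def)
qed

text \<open>At a word \<open>w\<close> only the term \<open>u = pack w\<close> can be nonzero, and
  this \<open>u\<close> is packed with the same tree as \<open>w\<close>.\<close>

lemma M_tree_apply: "M_tree T w = (if w \<in> words \<and> tree w = T then 1 else 0)"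
proof (cases "w \<in> words")
  case True
  then show ?thesis
    by (simp add: M_tree_def M_word_def finite_packed_tree packed_pack tree_pack)
qed (simp add: M_tree_def M_word_def)

subsection \<open>The sector of a letter\<close>

text \<open>Recursion on the list of children, with \<open>n\<close> the index of the first one,
  lets sectors be located by induction on a prefix of the children.\<close>

fun forest_sectors :: "nat \<Rightarrow> ptree list \<Rightarrow> sector list" where
  "forest_sectors n [] = []"
| "forest_sectors n (t # ts) = map (\<lambda>(p, s). (n # p, s)) (sectors t) @
     (if ts = [] then [] else ([], n) # forest_sectors (Suc n) ts)"

lemma sectors_Node: "sectors (Node ts) = forest_sectors 0 ts"
proof -
  have "concat (map (\<lambda>(i, t). map (\<lambda>(p, s). (i # p, s)) (sectors t) @
          (if Suc i < n + length ts then [([], i)] else [])) (enumerate n ts)) = forest_sectors n ts" for n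
  proof (induction ts arbitrary: n)
    case (Cons t ts)
    from Cons[of "Suc n"] show ?case by (cases ts) (simp_all del: sectors.simps)
  qed simp
  from this[of 0] show ?thesis by simp
qed

declare sectors.simps [simp del]

text \<open>The root sector after the last child in \<open>ts\<close> is preceded by all sectors
  inside \<open>ts\<close> and by the \<open>length ts - 1\<close> root sectors between these
  children; it exists because \<open>us\<close> is nonempty.\<close>

lemma forest_sectors_nth_root:
  assumes "ts \<noteq> []" and "us \<noteq> []" and "Suc i = (\<Sum>t\<leftarrow>ts. length (sectors t)) + length ts"
  shows "forest_sectors n (ts @ us) ! i = ([], n + (length ts - 1))"
  using assms
proof (induction ts arbitrary: n i)
  case (Cons t ts)
  show ?case
  proof (cases ts)
    case Nil
    with Cons.prems show ?thesis by (simp add: nth_append)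
  next
    case (Cons t' ts')
    then have "i = length (sectors t) + Suc (i - Suc (length (sectors t)))"
      using Cons.prems by simp
    moreover have "forest_sectors (Suc n) (ts @ us) ! (i - Suc (length (sectors t)))
        = ([], Suc n + (length ts - 1))"
      using Cons Cons.prems by (intro Cons.IH) auto
    ultimately show ?thesis
      using Cons by (simp add: nth_append)
  qed
qed simp

text \<open>The sectors of \<open>t\<close> come after those inside \<open>ts\<close> and after one
  root sector for each child in \<open>ts\<close>.\<close>

lemma forest_sectors_nth_inner:
  assumes "i = (\<Sum>t\<leftarrow>ts. length (sectors t)) + length ts + j" and "j < length (sectors t)"
  shows "forest_sectors n (ts @ t # us) ! i = map_prod (Cons (n + length ts)) id (sectors t ! j)"
  using assms
proof (induction ts arbitrary: n i)
  case Nil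
  then show ?case by (simp add: nth_append map_prod_def)
next
  case (Cons t' ts)
  have "i = length (sectors t') + Suc (i - Suc (length (sectors t')))"
    using Cons.prems by simp
  moreover have "forest_sectors (Suc n) (ts @ t # us) ! (i - Suc (length (sectors t')))
      = map_prod (Cons (Suc n + length ts)) id (sectors t ! j)"
    using Cons.prems by (intro Cons.IH) auto
  ultimately show ?case by (simp add: nth_append id_def)
qed

text \<open>The last block of \<open>x\<close> and the first block of \<open>y\<close> merge into
  one block straddling the junction; all other blocks survive unchanged.\<close>

lemma split_at_append:
  "split_at m (x @ y) = butlast (split_at m x) @
     (last (split_at m x) @ hd (split_at m y)) # tl (split_at m y)"
proof (induction x)
  case (Cons c x)
  then show ?case by (cases "split_at m x") auto
qed simp

lemma split_at_append_sep: "split_at m (x @ m # y) = split_at m x @ split_at m y"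
  by (simp add: split_at_append)

text \<open>Translates the position \<open>length x\<close> into a position inside the straddling
  block: before it lie the complete blocks of \<open>x\<close>, each followed by one
  separator.\<close>

lemma sum_length_butlast_split_at:
  "(\<Sum>v\<leftarrow>butlast (split_at m x). length v) + length (butlast (split_at m x))
     + length (last (split_at m x)) = length x"
proof -
  obtain L l where "split_at m x = L @ [l]"
    by (metis rev_exhaust split_at_nonempty)
  then show ?thesis using sum_length_split_at[of m x] by simp
qed

lemma tree_append_Max:
  assumes "\<And>c. c \<in> set (x @ m # y) \<Longrightarrow> c \<le> m"
  shows "tree (x @ m # y) = Node (map tree (split_at m x) @ map tree (split_at m y))"
  using tree_eq_Node[of m "x @ m # y"] assms by (simp add: split_at_append_sep)

lemma sector_Max:
  assumes "\<And>c. c \<in> set (x @ m # y) \<Longrightarrow> c \<le> m"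
  shows "sectors (tree (x @ m # y)) ! length x = ([], length (split_at m x) - 1)"
  using tree_append_Max[of x m y] assms sum_length_split_at[of m x]
    forest_sectors_nth_root[of "map tree (split_at m x)" "map tree (split_at m y)" "length x" 0]
  by (simp add: sectors_Node length_sectors_tree comp_def)

lemma tree_append_inner:
  assumes "m \<in> set (x @ y)" and "\<And>c. c \<in> set (x @ y) \<Longrightarrow> c \<le> m"
  shows "tree (x @ y) = Node (map tree (butlast (split_at m x)) @
    tree (last (split_at m x) @ hd (split_at m y)) # map tree (tl (split_at m y)))"
  using tree_eq_Node[OF assms] by (simp add: split_at_append)

text \<open>The descent step: a letter below the maximum lies in the straddling block, and the index
  of this child is the number of complete blocks before it.\<close>

lemma sector_inner:
  assumes "m \<in> set (x @ a # y)" and "\<And>c. c \<in> set (x @ a # y) \<Longrightarrow> c \<le> m" and "a \<noteq> m"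
  shows "sectors (tree (x @ a # y)) ! length x =
    map_prod (Cons (length (butlast (split_at m x)))) id
      (sectors (tree (last (split_at m x) @ a # hd (split_at m y))) ! length (last (split_at m x)))"
  using sum_length_butlast_split_at[of m x]
    forest_sectors_nth_inner[of "length x" "map tree (butlast (split_at m x))"
      "length (last (split_at m x))" "tree (last (split_at m x) @ a # hd (split_at m y))" 0]
    tree_append_inner[OF assms(1,2)] assms(3)
  by (simp add: sectors_Node length_sectors_tree comp_def del: length_butlast)

lemma length_last_hd_less:
  assumes "m \<in> set (x @ y)"
  shows "length (last (split_at m x) @ hd (split_at m y)) < length (x @ y)"
  using split_at_length_less[OF assms, of "last (split_at m x) @ hd (split_at m y)"]
  by (simp add: split_at_append)

subsection \<open>Doubling a letter\<close>

text \<open>If exactly one of the two letters is maximal, its sector sits at the root while the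
  other has a nonempty path. If neither is, both lie in the same block and the induction applies
  there.\<close>

lemma same_vertex_imp_eq:
  assumes "fst (sectors (tree (x @ a # b # y)) ! length x) =
    fst (sectors (tree (x @ a # b # y)) ! Suc (length x))"
  shows "a = b"
  using assms
proof (induction "x @ a # b # y" arbitrary: x y rule: length_induct)
  case 1
  let ?w = "x @ a # b # y"
  obtain m where m: "m \<in> set ?w" "\<And>c. c \<in> set ?w \<Longrightarrow> c \<le> m"
    using obtain_max_letter[of ?w] by blast
  \<comment> \<open>Regrouping makes \<open>b\<close> the distinguished letter, at position
    \<open>Suc (length x)\<close>.\<close>
  have mb: "m \<in> set ((x @ [a]) @ b # y)" "\<And>c. c \<in> set ((x @ [a]) @ b # y) \<Longrightarrow> c \<le> m"
    using m by auto
  show ?case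
  proof (cases "a = m \<or> b = m")
    case True
    show ?thesis
      using True sector_Max[of x m "b # y"] sector_Max[of "x @ [a]" m y]
        sector_inner[of m x a "b # y"] sector_inner[OF mb] m 1(2)
      by (cases "a = m"; cases "b = m") (auto simp: fst_map_prod)
  next
    case False
    let ?x = "last (split_at m x)" and ?y = "hd (split_at m y)"
    have "length (?x @ a # b # ?y) < length ?w"
      using length_last_hd_less[OF m(1)] False by simp
    moreover have "fst (sectors (tree (?x @ a # b # ?y)) ! length ?x) =
        fst (sectors (tree (?x @ a # b # ?y)) ! Suc (length ?x))"
      using 1(2) sector_inner[OF m] sector_inner[OF mb] False
      by (simp add: split_at_append fst_map_prod)
    ultimately show ?thesis using 1(1) by blast
  qed
qed

lemma glue_tree_double:
  assumes "sectors (tree (x @ a # a # y)) ! length x = (p, i)"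
  shows "fst (sectors (tree (x @ a # a # y)) ! Suc (length x)) = p"
    and "delete_child p (Suc i) (tree (x @ a # a # y)) = tree (x @ a # y)"
proof -
  have "fst (sectors (tree (x @ a # a # y)) ! Suc (length x)) = p \<and>
      delete_child p (Suc i) (tree (x @ a # a # y)) = tree (x @ a # y)"
    using assms
  \<comment> \<open>The descent strips the head of \<open>p\<close> but keeps the child index
    \<open>i\<close>, so \<open>p\<close> is generalized and \<open>i\<close> is fixed.\<close>
  proof (induction "x @ a # a # y" arbitrary: x y p rule: length_induct)
    case 1
    let ?w = "x @ a # a # y"
    obtain m where m: "m \<in> set ?w" "\<And>c. c \<in> set ?w \<Longrightarrow> c \<le> m"
      using obtain_max_letter[of ?w] by blast
    have mb: "m \<in> set ((x @ [a]) @ a # y)" "\<And>c. c \<in> set ((x @ [a]) @ a # y) \<Longrightarrow> c \<le> m"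
      and mc: "m \<in> set (x @ a # y)" "\<And>c. c \<in> set (x @ a # y) \<Longrightarrow> c \<le> m"
      using m by auto
    show ?case
    proof (cases "a = m")
      case True
      \<comment> \<open>Hence child \<open>Suc i\<close> of the root is the leaf coming from the
        empty block between the two copies of \<open>m\<close>.\<close>
      have "p = []" "Suc i = length (split_at m x)"
        using sector_Max[of x m "a # y"] m 1(2) True by (auto simp: Suc_le_eq)
      then show ?thesis
        using sector_Max[of "x @ [a]" m y] tree_append_Max[of x m "m # y"] tree_append_Max[of x m y] m True
        by simp
    next
      case False
      let ?x = "last (split_at m x)" and ?y = "hd (split_at m y)"
      let ?n = "length (butlast (split_at m x))"
      obtain q where q: "sectors (tree (?x @ a # a # ?y)) ! length ?x = (q, i)" "p = ?n # q"
        using 1(2) sector_inner[OF m] False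
        by (cases "sectors (tree (?x @ a # a # ?y)) ! length ?x") (simp del: length_butlast)
      have "length (?x @ a # a # ?y) < length ?w"
        using length_last_hd_less[OF m(1)] False by simp
      with q(1) 1(1) have
        "fst (sectors (tree (?x @ a # a # ?y)) ! Suc (length ?x)) = q"
        "delete_child q (Suc i) (tree (?x @ a # a # ?y)) = tree (?x @ a # ?y)"
        by blast+
      moreover have "delete_child (length ts # q) c (Node (ts @ t # us))
          = Node (ts @ delete_child q c t # us)" for ts us c t
        by simp
      from this[of "map tree (butlast (split_at m x))"]
      have "delete_child p c (Node (map tree (butlast (split_at m x)) @ t # us))
          = Node (map tree (butlast (split_at m x)) @ delete_child q c t # us)" for c t us
        by (simp only: length_map q(2))
      ultimately show ?thesis
        using tree_append_inner[OF m] tree_append_inner[OF mc] sector_inner[OF mb] False q(2)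
        by (simp add: split_at_append fst_map_prod)
    qed
  qed
  then show "fst (sectors (tree (x @ a # a # y)) ! Suc (length x)) = p"
    and "delete_child p (Suc i) (tree (x @ a # a # y)) = tree (x @ a # y)" by auto
qed

text \<open>Doubling at a given position is well defined on trees, which makes gluing invertible for
  fixed \<open>k\<close>. The tree determines the sector at that position, hence whether the letter
  is maximal and which child contains it, so the blocks can be compared one by one.\<close>

lemma tree_double_cong:
  assumes "tree (x @ a # y) = tree (x' @ b # y')" and "length x = length x'"
  shows "tree (x @ a # a # y) = tree (x' @ b # b # y')"
  using assms
proof (induction "x @ a # y" arbitrary: x y x' y' rule: length_induct)
  case 1
  obtain m where m: "m \<in> set (x @ a # y)" "\<And>c. c \<in> set (x @ a # y) \<Longrightarrow> c \<le> m"
    using obtain_max_letter[of "x @ a # y"] by blast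
  obtain m' where m': "m' \<in> set (x' @ b # y')" "\<And>c. c \<in> set (x' @ b # y') \<Longrightarrow> c \<le> m'"
    using obtain_max_letter[of "x' @ b # y'"] by blast
  have d: "m \<in> set (x @ a # a # y)" "\<And>c. c \<in> set (x @ a # a # y) \<Longrightarrow> c \<le> m"
    and d': "m' \<in> set (x' @ b # b # y')" "\<And>c. c \<in> set (x' @ b # b # y') \<Longrightarrow> c \<le> m'"
    using m m' by auto
  have sec: "sectors (tree (x @ a # y)) ! length x = sectors (tree (x' @ b # y')) ! length x'"
    using 1 by simp
  show ?case
  proof (cases "a = m")
    case True
    \<comment> \<open>The common sector has an empty path exactly when the letter is
      maximal.\<close>
    then have b: "b = m'"
      using sec sector_Max[of x m y] sector_inner[OF m'] m
      by (cases "b = m'") (auto simp: prod_eq_iff)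
    then have "length (split_at m x) - 1 = length (split_at m' x') - 1"
      using sec sector_Max[of x m y] sector_Max[of x' m' y'] m m' True by simp
    \<comment> \<open>Both lists are nonempty, so the truncated subtraction loses nothing.\<close>
    then have "length (split_at m x) = length (split_at m' x')"
      using split_at_nonempty[of m x] split_at_nonempty[of m' x']
      by (metis One_nat_def Suc_pred length_greater_0_conv)
    then have "map tree (split_at m x) = map tree (split_at m' x')"
        "map tree (split_at m y) = map tree (split_at m' y')"
      using 1(2) tree_append_Max[of x m y] tree_append_Max[of x' m' y'] m m' True b by simp_all
    then show ?thesis
      using tree_append_Max[of x m "a # y"] tree_append_Max[of x' m' "b # y'"] d d' True b by simp
  next
    case False
    then have b: "b \<noteq> m'"
      using sec sector_Max[of x' m' y'] sector_inner[OF m] m'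
      by (auto simp: prod_eq_iff)
    let ?x = "last (split_at m x)" and ?y = "hd (split_at m y)"
    let ?x' = "last (split_at m' x')" and ?y' = "hd (split_at m' y')"
    let ?xs = "butlast (split_at m x)" and ?xs' = "butlast (split_at m' x')"
    have "length ?xs = length ?xs'"
      using sec sector_inner[OF m False] sector_inner[OF m' b]
      by (simp add: prod_eq_iff del: length_butlast)
    then have eq: "map tree ?xs = map tree ?xs'"
        "tree (?x @ a # ?y) = tree (?x' @ b # ?y')"
        "map tree (tl (split_at m y)) = map tree (tl (split_at m' y'))"
      using 1(2) tree_append_inner[OF m] tree_append_inner[OF m'] False b
      by (simp_all del: length_butlast)
    \<comment> \<open>Block lengths are recovered from the trees by counting sectors; this places
      both letters at the same position in their straddling blocks.\<close>
    have "map (\<lambda>v. length (sectors (tree v))) ?xs = map (\<lambda>v. length (sectors (tree v))) ?xs'"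
      using arg_cong[OF eq(1), of "map (\<lambda>t. length (sectors t))"] by (simp add: comp_def)
    then have "map length ?xs = map length ?xs'"
      by (simp add: length_sectors_tree)
    then have "length ?x = length ?x'"
      using sum_length_butlast_split_at[of m x] sum_length_butlast_split_at[of m' x'] 1(3)
        \<open>length ?xs = length ?xs'\<close>
      by (simp del: length_butlast)
    moreover have "length (?x @ a # ?y) < length (x @ a # y)"
      using length_last_hd_less[OF m(1)] False by simp
    ultimately have "tree (?x @ a # a # ?y) = tree (?x' @ b # b # ?y')"
      using 1(1) eq(2) by blast
    then show ?thesis
      using tree_append_inner[OF d] tree_append_inner[OF d'] False b eq by simp
  qed
qed

subsection \<open>The operators on series\<close>

lemma d_op_apply:
  assumes "1 \<le> k" and "length x = k - 1"
  shows "d_op k f (x @ a # y) = (if x @ a # a # y \<in> words then f (x @ a # a # y) else 0)"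
proof -
  have "{w \<in> words. d_word k w = Some (x @ a # y)} =
      (if x @ a # a # y \<in> words then {x @ a # a # y} else {})"
    using assms by (auto simp: d_word_eq_Some_iff)
  then show ?thesis by (simp add: d_op_def)
qed

text \<open>Every nonzero value of \<open>d_word k\<close> is a word \<open>u a v\<close> with
  \<open>|u| = k - 1\<close>, so its length is at least \<open>k\<close>.\<close>

lemma d_op_short:
  assumes "1 \<le> k" and "length v < k"
  shows "d_op k f v = 0"
proof -
  have "{w \<in> words. d_word k w = Some v} = {}"
    using assms by (auto simp: d_word_eq_Some_iff)
  then show ?thesis unfolding d_op_def by (simp only: sum.empty)
qed

theorem theorem5p6:
  fixes w :: "nat list" and T :: ptree and n k :: nat
  assumes "w \<in> words" and "length w = n" and "T = tree w"
    and "1 \<le> k" and "k \<le> n - 1"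
  shows "(\<not> same_vertex T k \<longrightarrow> d_op k (M_tree T :: 'k::field series) = (\<lambda>_. 0)) \<and>
         (same_vertex T k \<longrightarrow> d_op k (M_tree T :: 'k::field series) = M_tree (glue T k))"
proof -
  have double: "same_vertex (tree (x @ a # a # y)) k"
      "glue (tree (x @ a # a # y)) k = tree (x @ a # y)" if "length x = k - 1" for x a y
    using glue_tree_double[of x a y] that assms(4)
    by (auto simp: same_vertex_def glue_def prod_eq_iff split: prod.split)
  have split: "\<exists>x a y. v = x @ a # y \<and> length x = k - 1" if "k \<le> length v" for v :: "nat list"
    using that assms(4) by (intro exI[of _ "take (k - 1) v"] exI[of _ "v ! (k - 1)"]
        exI[of _ "drop k v"]) (use id_take_nth_drop[of "k - 1" v] in auto)
  have "d_op k (M_tree T :: 'k series) v = 0" if "\<not> same_vertex T k" for v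
  proof (cases "k \<le> length v")
    case True
    then obtain x a y where v: "v = x @ a # y" "length x = k - 1"
      using split by blast
    \<comment> \<open>Any doubled word has its \<open>k\<close>-th and next sectors at one vertex,
      which \<open>T\<close> does not.\<close>
    then have "tree (x @ a # a # y) \<noteq> T" using that double by blast
    then show ?thesis
      using v assms(4) by (simp add: d_op_apply M_tree_apply)
  qed (use assms(4) in \<open>simp add: d_op_short\<close>)
  moreover have "d_op k (M_tree T :: 'k series) v = M_tree (glue T k) v" if "same_vertex T k" for v
  proof -
    obtain x a b y where w: "w = x @ a # b # y" "length x = k - 1"
    proof -
      obtain x a z where "w = x @ a # z" "length x = k - 1"
        using split[of w] assms(2,4,5) by (meson diff_le_self le_trans)
      moreover from this have "z \<noteq> []" using assms by auto
      ultimately show thesis using that by (cases z) auto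
    qed
    \<comment> \<open>So \<open>w\<close> is itself a doubled word, and \<open>glue T k\<close> is
      the tree of the word with the repetition removed.\<close>
    have "a = b"
      using same_vertex_imp_eq[of x a b y] that w assms by (simp add: same_vertex_def)
    with w double assms have glue: "glue T k = tree (x @ a # y)" by simp
    show ?thesis
    proof (cases "k \<le> length v")
      case True
      then obtain x' c y' where v: "v = x' @ c # y'" "length x' = k - 1"
        using split by blast
      have "tree (x' @ c # c # y') = T \<longleftrightarrow> tree v = glue T k"
      proof
        assume "tree (x' @ c # c # y') = T"
        then show "tree v = glue T k" using double(2)[OF v(2), of c y'] v(1) by simp
      next
        \<comment> \<open>Now \<open>v\<close> and \<open>x @ a # y\<close> have the same tree, so
          doubling both at position \<open>k\<close> gives equal trees, the second being
          \<open>T\<close>.\<close>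
        assume "tree v = glue T k"
        then have "tree (x' @ c # y') = tree (x @ a # y)" by (simp only: v(1) glue)
        from tree_double_cong[OF this] show "tree (x' @ c # c # y') = T"
          using v(2) w \<open>a = b\<close> assms(3) by simp
      qed
      moreover have "x' @ c # c # y' \<in> words \<longleftrightarrow> v \<in> words"
        using v by (auto simp: words_def)
      ultimately show ?thesis
        using v assms(4) by (simp add: d_op_apply M_tree_apply)
    next
      case False
      have "tree v \<noteq> glue T k"
      proof
        assume "tree v = glue T k"
        then have "length v = length (x @ a # y)"
          unfolding glue by (metis length_sectors_tree)
        with False w(2) assms(4) show False by simp
      qed
      with False assms(4) show ?thesis by (simp add: d_op_short M_tree_apply)
    qed
  qed
  ultimately show ?thesis by auto
qed

end
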